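(* Let $Y$ and $\overline{Y}$ be two systems of $N$ competing Brownian particles with the same drift coefficients $(g_k)_{1 \le k \le N}$, diffusion coefficients $(\sigma_k^2)_{1 \le k \le N}$ and parameters of collision $(q^{\pm}_k)_{1 \le k \le N}$, and with the same driving Brownian motions. Let $Z$, $\overline{Z}$ be the corresponding gap processes, and let $L$, $\overline{L}$ be the corresponding vectors of collision terms. (i) If $Y(0) \le \overline{Y}(0)$, then $Y(t) \le \overline{Y}(t)$ for $t \ge 0$. (ii) If $Z(0) \le \overline{Z}(0)$, then $Z(t) \le \overline{Z}(t)$ for $t \ge 0$, and $L(t) - L(s) \ge \overline{L}(t) - \overline{L}(s)$ for $0 \le s \le t$.
   Context: Vectors are compared componentwise. $\mathcal{W}_N := \{y \in \mathbb{R}^N \mid y_1 \le \ldots \le y_N\}$. Parameters of collision for $N$ particles are real numbers $q^{\pm}_1, \ldots, q^{\pm}_N$ with $q^+_{k+1} + q^-_k = 1$ for $k = 1, \ldots, N-1$ and $0 < q^{\pm}_k < 1$ for $k = 1, \ldots, N$. System of $N$ competing Brownian particles: on a filtered probability space satisfying the usual conditions, take i.i.d. standard Brownian motions $B_1,\ldots,B_N$ (driving Brownian motions), real numbers $g_1,\ldots,g_N$ (drift coefficients), positive reals $\sigma_1,\ldots,\sigma_N$ (diffusion coefficients $\sigma_k^2$), and parameters of collision $(q^{\pm}_k)$. The system is a continuous adapted $\mathcal{W}_N$-valued process $Y = (Y_1,\ldots,Y_N)'$ together with continuous adapted processes $L_{(1,2)},\ldots,L_{(N-1,N)}$ (collision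 terms, or local times of collision) such that, with $L_{(0,1)} \equiv 0 \equiv L_{(N,N+1)}$, $$Y_k(t) = Y_k(0) + g_k t + \sigma_k B_k(t) + q^+_k L_{(k-1,k)}(t) - q^-_k L_{(k,k+1)}(t),\quad k=1,\ldots,N,\ t\ge 0,$$ where each $L_{(k,k+1)}$ is nondecreasing, starts from $0$, and can increase only when $Y_k = Y_{k+1}$. It exists in the strong sense and is pathwise unique. The vector of collision terms is $L = (L_{(1,2)},\ldots,L_{(N-1,N)})'$ and the gap process is $Z = (Z_1,\ldots,Z_{N-1})'$ with $Z_k(t) = Y_{k+1}(t) - Y_k(t)$. *)

theory Defs
  imports "HOL-Probability.Probability"
begin

text \<open>
  Conventions. A vector in \<open>\<real>\<^sup>N\<close> is a function \<open>nat \<Rightarrow> real\<close> of which only the components with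
  index in \<open>{1..N}\<close> matter. An \<open>N\<close>-dimensional process is written \<open>X k t \<omega>\<close> with component \<open>k\<close>,
  time \<open>t \<ge> 0\<close> and outcome \<open>\<omega>\<close>; its values at negative times are irrelevant. Pathwise
  properties are required almost surely, with one null set for all times.
\<close>

definition vec_le :: "nat \<Rightarrow> (nat \<Rightarrow> real) \<Rightarrow> (nat \<Rightarrow> real) \<Rightarrow> bool" where
  "vec_le n x y \<longleftrightarrow> (\<forall>k\<in>{1..n}. x k \<le> y k)"

definition weyl_chamber :: "nat \<Rightarrow> (nat \<Rightarrow> real) set" where
  "weyl_chamber N = {y. \<forall>k\<in>{1..<N}. y k \<le> y (Suc k)}"

text \<open>
  The library locale \<open>filtration\<close> is indexed by a whole type, so \<open>F\<close> is also defined at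
  negative times. This carries no information: one may take \<open>F t = F 0\<close> for \<open>t < 0\<close>.
\<close>

locale usual_filtered_prob_space =
  prob_space M + complete_measure M + filtration "space M" F
  for M :: "'a measure" and F :: "real \<Rightarrow> 'a measure" +
  assumes F_subalgebra: "0 \<le> t \<Longrightarrow> subalgebra M (F t)"
    and F_null_sets: "null_sets M \<subseteq> sets (F 0)"
    and F_right_continuous: "0 \<le> t \<Longrightarrow> sets (F t) = (\<Inter>s\<in>{t<..}. sets (F s))"

definition continuous_adapted ::
  "'a measure \<Rightarrow> (real \<Rightarrow> 'a measure) \<Rightarrow> (real \<Rightarrow> 'a \<Rightarrow> real) \<Rightarrow> bool" where
  "continuous_adapted M F X \<longleftrightarrow>
     (\<forall>t\<ge>0. X t \<in> borel_measurable (F t)) \<and>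
     (AE \<omega> in M. continuous_on {0..} (\<lambda>t. X t \<omega>))"

definition standard_brownian_motion ::
  "'a measure \<Rightarrow> (real \<Rightarrow> 'a measure) \<Rightarrow> (real \<Rightarrow> 'a \<Rightarrow> real) \<Rightarrow> bool" where
  "standard_brownian_motion M F B \<longleftrightarrow>
     continuous_adapted M F B \<and>
     (AE \<omega> in M. B 0 \<omega> = 0) \<and>
     (\<forall>s t. 0 \<le> s \<and> s < t \<longrightarrow>
        distributed M lborel (\<lambda>\<omega>. B t \<omega> - B s \<omega>) (normal_density 0 (sqrt (t - s))) \<and>
        prob_space.indep_set M (sets (F s))
          (sets (vimage_algebra (space M) (\<lambda>\<omega>. B t \<omega> - B s \<omega>) borel)))"

text \<open>Independence is that of the whole paths, as random elements of \<open>\<real>\<^bsup>[0,\<infinity>)\<^esup>\<close>.\<close>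

definition iid_brownian_motions ::
  "'a measure \<Rightarrow> (real \<Rightarrow> 'a measure) \<Rightarrow> nat \<Rightarrow> (nat \<Rightarrow> real \<Rightarrow> 'a \<Rightarrow> real) \<Rightarrow> bool" where
  "iid_brownian_motions M F N B \<longleftrightarrow>
     (\<forall>k\<in>{1..N}. standard_brownian_motion M F (B k)) \<and>
     prob_space.indep_vars M (\<lambda>_. PiM {0..} (\<lambda>_. borel))
       (\<lambda>k \<omega>. \<lambda>t\<in>{0..}. B k t \<omega>) {1..N}"

definition collision_parameters :: "nat \<Rightarrow> (nat \<Rightarrow> real) \<Rightarrow> (nat \<Rightarrow> real) \<Rightarrow> bool" where
  "collision_parameters N qp qm \<longleftrightarrow>
     (\<forall>k\<in>{1..<N}. qp (Suc k) + qm k = 1) \<and>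
     (\<forall>k\<in>{1..N}. 0 < qp k \<and> qp k < 1 \<and> 0 < qm k \<and> qm k < 1)"

text \<open>
  \<open>L k\<close> is the collision term \<open>L\<^bsub>(k,k+1)\<^esub>\<close> for \<open>0 \<le> k \<le> N\<close>; those for \<open>k = 0\<close> and \<open>k = N\<close> vanish.
  That \<open>L k\<close> can increase only when \<open>Y\<^sub>k = Y\<^bsub>k+1\<^esub>\<close> is expressed as: over every time interval on
  which it has a positive increment there is a time with \<open>Y\<^sub>k = Y\<^bsub>k+1\<^esub>\<close>. By continuity this
  makes \<open>L k\<close> locally constant on the open set of times with \<open>Y\<^sub>k \<noteq> Y\<^bsub>k+1\<^esub>\<close>, that is, this set
  is null for the Stieltjes measure of \<open>L k\<close>.
\<close>

definition competing_brownian_particles ::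
  "'a measure \<Rightarrow> (real \<Rightarrow> 'a measure) \<Rightarrow> nat \<Rightarrow> (nat \<Rightarrow> real) \<Rightarrow> (nat \<Rightarrow> real) \<Rightarrow>
   (nat \<Rightarrow> real) \<Rightarrow> (nat \<Rightarrow> real) \<Rightarrow> (nat \<Rightarrow> real \<Rightarrow> 'a \<Rightarrow> real) \<Rightarrow>
   (nat \<Rightarrow> real \<Rightarrow> 'a \<Rightarrow> real) \<Rightarrow> (nat \<Rightarrow> real \<Rightarrow> 'a \<Rightarrow> real) \<Rightarrow> bool" where
  "competing_brownian_particles M F N g \<sigma> qp qm B Y L \<longleftrightarrow>
     usual_filtered_prob_space M F \<and>
     iid_brownian_motions M F N B \<and>
     (\<forall>k\<in>{1..N}. 0 < \<sigma> k) \<and>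
     collision_parameters N qp qm \<and>
     (\<forall>k\<in>{1..N}. continuous_adapted M F (Y k)) \<and>
     (AE \<omega> in M. \<forall>t\<ge>0. (\<lambda>k. Y k t \<omega>) \<in> weyl_chamber N) \<and>
     (\<forall>k\<in>{1..<N}. continuous_adapted M F (L k)) \<and>
     (AE \<omega> in M. \<forall>t\<ge>0. L 0 t \<omega> = 0 \<and> L N t \<omega> = 0) \<and>
     (AE \<omega> in M. \<forall>t\<ge>0. \<forall>k\<in>{1..N}.
        Y k t \<omega> = Y k 0 \<omega> + g k * t + \<sigma> k * B k t \<omega>
                  + qp k * L (k - 1) t \<omega> - qm k * L k t \<omega>) \<and>
     (AE \<omega> in M. \<forall>k\<in>{1..<N}.
        L k 0 \<omega> = 0 \<and>
        mono_on {0..} (\<lambda>t. L k t \<omega>) \<and>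
        (\<forall>s t. 0 \<le> s \<and> s < t \<and> L k s \<omega> < L k t \<omega> \<longrightarrow>
           (\<exists>u\<in>{s..t}. Y k u \<omega> = Y (Suc k) u \<omega>)))"

definition gap_process ::
  "(nat \<Rightarrow> real \<Rightarrow> 'a \<Rightarrow> real) \<Rightarrow> nat \<Rightarrow> real \<Rightarrow> 'a \<Rightarrow> real" where
  "gap_process Y k t \<omega> = Y (Suc k) t \<omega> - Y k t \<omega>"

end

theory Submission
  imports Defs
begin

text \<open>
  Both parts hold path by path. For (i), let \<open>f = Y' - Y\<close>. With weights \<open>w\<close> chosen such that
  \<open>w\<^sub>j q\<^sup>-\<^sub>j = w\<^bsub>j+1\<^esub> q\<^sup>+\<^bsub>j+1\<^esub>\<close>, the function \<open>\<Sum> w\<^sub>k (f\<^sub>k \<and> 0)\<^sup>2\<close> is nonincreasing: \<open>L'\<^sub>j\<close> grows only when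
  \<open>Y'\<^sub>j = Y'\<^bsub>j+1\<^esub>\<close>, hence \<open>f\<^bsub>j+1\<^esub> \<le> f\<^sub>j\<close>, and \<open>L\<^sub>j\<close> only when \<open>f\<^sub>j \<le> f\<^bsub>j+1\<^esub>\<close>. For (ii), each gap is a
  one-dimensional Skorokhod reflection whose input depends on the collision terms of the
  neighbouring gaps. The one-dimensional reflection is monotone, so a Picard iteration started at
  \<open>L'\<close> keeps the required order relations, and it converges to \<open>L\<close> since the feedback matrix is a
  contraction in a suitable weighted maximum norm.
\<close>

section \<open>One-dimensional reflection\<close>

text \<open>The regulator of the Skorokhod map: \<open>u + reflector u\<close> is \<open>u\<close>
  reflected at 0. Later lemmas ask only for inputs bounded on compact intervals, since Picard
  iterates are controlled through monotonicity and not through continuity.\<close>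

definition reflector :: "(real \<Rightarrow> real) \<Rightarrow> real \<Rightarrow> real" where
  "reflector u t = (SUP s\<in>{0..t}. max 0 (- u s))"

lemma reflector_upper:
  assumes "bounded (u ` {0..t})" "s \<in> {0..t}"
  shows "max 0 (- u s) \<le> reflector u t"
proof -
  obtain c where c: "\<And>r. r \<in> {0..t} \<Longrightarrow> \<bar>u r\<bar> \<le> c"
    using assms(1) unfolding bounded_iff real_norm_def by blast
  have "max 0 (- u r) \<le> max 0 c" if "r \<in> {0..t}" for r
    using c[OF that] by linarith
  then have "bdd_above ((\<lambda>r. max 0 (- u r)) ` {0..t})"
    by (intro bdd_aboveI2[where M = "max 0 c"]) auto
  then show ?thesis
    unfolding reflector_def using assms(2) by (intro cSUP_upper) auto
qed

lemma reflector_least: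
  assumes "0 \<le> t" "\<And>s. s \<in> {0..t} \<Longrightarrow> max 0 (- u s) \<le> c"
  shows "reflector u t \<le> c"
  unfolding reflector_def using assms by (intro cSUP_least) auto

text \<open>Lowering the input by at most \<open>c\<close> raises each \<open>max 0 (- v s)\<close>
  by at most \<open>c\<close>. Applied in both directions, this is the 1-Lipschitz bound behind the
  contraction estimate.\<close>

lemma reflector_le_add:
  assumes "0 \<le> t" "bounded (v ` {0..t})" "0 \<le> c" "\<And>s. s \<in> {0..t} \<Longrightarrow> v s \<le> u s + c"
  shows "reflector u t \<le> reflector v t + c"
proof (rule reflector_least[OF assms(1)])
  fix s assume s: "s \<in> {0..t}"
  show "max 0 (- u s) \<le> reflector v t + c"
    using reflector_upper[OF assms(2) s] assms(4)[OF s] assms(3) by linarith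
qed

lemma reflector_mono:
  assumes "bounded (u ` {0..t})" "0 \<le> s" "s \<le> t"
  shows "reflector u s \<le> reflector u t"
  using assms by (intro reflector_least reflector_upper) auto

text \<open>As \<open>u' - u\<close> is nondecreasing, its largest value on \<open>{0..t}\<close> is
  the final one. The regulator can drop by no more than this value, which the free path
  gains.\<close>

lemma reflected_path_mono:
  assumes "0 \<le> t" "bounded (u' ` {0..t})"
    and "u 0 \<le> u' 0" "mono_on {0..} (\<lambda>s. u' s - u s)"
  shows "u t + reflector u t \<le> u' t + reflector u' t"
proof -
  have inc: "u' r - u r \<le> u' s - u s" if "0 \<le> r" "r \<le> s" for r s
    using mono_onD[OF assms(4), of r s] that by simp
  have "reflector u t \<le> reflector u' t + (u' t - u t)"
  proof (rule reflector_le_add[OF assms(1,2)])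
    show "0 \<le> u' t - u t" using inc[of 0 t] assms by simp
    show "u' s \<le> u s + (u' t - u t)" if "s \<in> {0..t}" for s
      using inc[of s t] that by simp
  qed
  then show ?thesis by simp
qed

text \<open>Only inputs after \<open>s\<close> can raise the regulator beyond its value at
  \<open>s\<close>. There \<open>- u' r\<close> is at most \<open>- u r - (u' s - u s)\<close>, and
  the order of the reflected paths at \<open>s\<close> bounds \<open>u s - u' s\<close> by
  \<open>reflector u' s - reflector u s\<close>.\<close>

lemma reflector_increment_antimono:
  assumes "\<And>t. bounded (u ` {0..t})" "\<And>t. bounded (u' ` {0..t})"
    and "u 0 \<le> u' 0" "mono_on {0..} (\<lambda>s. u' s - u s)"
    and "0 \<le> s" "s \<le> t"
  shows "reflector u' t - reflector u' s \<le> reflector u t - reflector u s"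
proof -
  have "reflector u' t \<le> reflector u t - reflector u s + reflector u' s"
  proof (rule reflector_least)
    show "0 \<le> t" using assms by simp
    fix r assume r: "r \<in> {0..t}"
    have mono: "reflector u s \<le> reflector u t"
      using assms by (intro reflector_mono) auto
    have nonneg: "0 \<le> reflector u' s"
      using reflector_upper[OF assms(2), of s s] assms(5) by simp
    show "max 0 (- u' r) \<le> reflector u t - reflector u s + reflector u' s"
    proof (cases "r \<le> s")
      case True
      then show ?thesis
        using reflector_upper[OF assms(2), of r s] r mono by simp
    next
      case False
      then have "u' s - u s \<le> u' r - u r"
        using mono_onD[OF assms(4), of s r] assms(5) by simp
      moreover have "u s + reflector u s \<le> u' s + reflector u' s"
        using assms by (intro reflected_path_mono) auto
      moreover have "- u r \<le> reflector u t"
        using reflector_upper[OF assms(1) r] by simp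
      ultimately show ?thesis using mono nonneg by simp
    qed
  qed
  then show ?thesis by simp
qed

lemma continuous_bounded_image:
  fixes z :: "real \<Rightarrow> real"
  assumes "continuous_on {0..} z"
  shows "bounded (z ` {0..t})"
  by (intro compact_imp_bounded compact_continuous_image continuous_on_subset[OF assms]) auto

lemma mono_bounded_image:
  fixes z :: "real \<Rightarrow> real"
  assumes "mono_on {0..} z"
  shows "bounded (z ` {0..t})"
proof -
  have "z ` {0..t} \<subseteq> {z 0..z t}"
    using mono_onD[OF assms] by auto
  then show ?thesis using bounded_closed_interval bounded_subset by blast
qed

text \<open>Uniqueness in the Skorokhod problem, in explicit form. Positivity of \<open>z\<close>
  and monotonicity of \<open>l\<close> give one inequality; for the other, \<open>l\<close> has been
  constant since the last zero of \<open>z\<close>, where \<open>l\<close> equals minus the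
  input.\<close>

lemma skorokhod_solution_eq_reflector:
  fixes z l :: "real \<Rightarrow> real"
  assumes cont: "continuous_on {0..} z" "continuous_on {0..} l"
    and nonneg: "\<And>t. 0 \<le> t \<Longrightarrow> 0 \<le> z t"
    and l: "l 0 = 0" "mono_on {0..} l"
    and growth: "\<And>s t. 0 \<le> s \<Longrightarrow> s < t \<Longrightarrow> l s < l t \<Longrightarrow> \<exists>u\<in>{s..t}. z u = 0"
    and "0 \<le> t"
  shows "l t = reflector (\<lambda>s. z s - l s) t"
proof (rule antisym)
  have mono: "l r \<le> l s" if "0 \<le> r" "r \<le> s" for r s
    using mono_onD[OF l(2), of r s] that by simp
  have bd: "bounded ((\<lambda>s. z s - l s) ` {0..t})"
    by (intro continuous_bounded_image continuous_on_diff cont)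
  show "reflector (\<lambda>s. z s - l s) t \<le> l t"
  proof (rule reflector_least[OF \<open>0 \<le> t\<close>])
    fix s assume "s \<in> {0..t}"
    then show "max 0 (- (z s - l s)) \<le> l t"
      using mono[of s t] mono[of 0 s] nonneg[of s] l(1) by simp
  qed
  show "l t \<le> reflector (\<lambda>s. z s - l s) t"
  proof (cases "l t \<le> 0")
    case True
    then show ?thesis
      using reflector_upper[OF bd, of 0] \<open>0 \<le> t\<close> by simp
  next
    case False
    define S where "S = {0..t} \<inter> z -` {0}"
    have "continuous_on {0..t} z"
      using cont(1) by (rule continuous_on_subset) auto
    then have "closed S"
      unfolding S_def by (intro continuous_closed_preimage) auto
    then have "compact S"
      unfolding S_def by (metis bounded_Int bounded_closed_interval compact_eq_bounded_closed)
    have "0 < t" using False l(1) \<open>0 \<le> t\<close> by (cases "t = 0") auto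
    then have "S \<noteq> {}"
      using growth[of 0 t] False l(1) unfolding S_def by fastforce
    then obtain \<tau> where \<tau>: "\<tau> \<in> S" "\<And>s. s \<in> S \<Longrightarrow> s \<le> \<tau>"
      using compact_attains_sup[OF \<open>compact S\<close>] by blast
    then have \<tau>': "0 \<le> \<tau>" "\<tau> \<le> t" "z \<tau> = 0" by (auto simp: S_def)
    have const: "l s = l t" if s: "\<tau> < s" "s \<le> t" for s
    proof (rule ccontr)
      assume "l s \<noteq> l t"
      then have "l s < l t" "s < t"
        using mono[of s t] s \<tau>' by (auto simp: less_le)
      then obtain u where "u \<in> {s..t}" "z u = 0"
        using growth[of s t] s(1) \<tau>'(1) by auto
      then show False
        using \<tau>(2)[of u] s \<tau>' by (auto simp: S_def)
    qed
    \<comment> \<open>Constancy is known only strictly after \<tau>, since an interval starting at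
      \<tau> contains a zero of \<open>z\<close>. Right continuity of \<open>l\<close> includes the
      endpoint.\<close>
    have "l \<tau> = l t"
    proof (cases "\<tau> = t")
      case False
      then have "\<tau> < t" using \<tau>' by simp
      have "(l \<longlongrightarrow> l \<tau>) (at \<tau> within {\<tau>..t})"
        using continuous_on_subset[OF cont(2), of "{\<tau>..t}"] \<tau>' by (auto simp: continuous_on_def)
      then have "(l \<longlongrightarrow> l \<tau>) (at_right \<tau>)"
        using \<open>\<tau> < t\<close> by (simp add: at_within_Icc_at_right)
      moreover have "\<forall>\<^sub>F s in at_right \<tau>. l s = l t"
        by (rule eventually_at_rightI[OF const \<open>\<tau> < t\<close>]) auto
      then have "(l \<longlongrightarrow> l t) (at_right \<tau>)"
        by (rule tendsto_eventually)
      ultimately show ?thesis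
        by (intro tendsto_unique[OF trivial_limit_at_right_real])
    qed simp
    then show ?thesis
      using reflector_upper[OF bd, of \<tau>] \<tau>' by simp
  qed
qed

section \<open>Weights\<close>

text \<open>Detailed balance between neighbouring particles: a collision term then acts on both of
  them with the same weight. The recursion is solved by a product.\<close>

lemma exists_balancing_weights:
  assumes "collision_parameters N qp qm"
  obtains w :: "nat \<Rightarrow> real" where "\<And>k. k \<in> {1..N} \<Longrightarrow> 0 < w k"
    and "\<And>k. k \<in> {1..<N} \<Longrightarrow> w k * qm k = w (Suc k) * qp (Suc k)"
proof
  define w where "w k = (\<Prod>j\<in>{1..<k}. qm j / qp (Suc j))" for k
  have pos: "0 < qp k" "0 < qm k" if "k \<in> {1..N}" for k
    using assms that by (auto simp: collision_parameters_def)
  show "0 < w k" if "k \<in> {1..N}" for k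
    unfolding w_def using that pos by (intro prod_pos) auto
  show "w k * qm k = w (Suc k) * qp (Suc k)" if "k \<in> {1..<N}" for k
    using that pos[of "Suc k"] by (simp add: w_def)
qed

text \<open>
  The transpose of the feedback matrix is the transition matrix of a killed birth-death chain with
  reversible measure \<open>p\<close>, and \<open>c\<close> is strictly superharmonic for it; so \<open>p c\<close> is strictly
  superharmonic for the matrix itself.
\<close>
lemma exists_contraction_weights:
  assumes "collision_parameters N qp qm"
  obtains h :: "nat \<Rightarrow> real" and \<theta> where "0 \<le> \<theta>" "\<theta> < 1" "h 0 = 0"
    "\<And>k. k \<in> {1..N} \<Longrightarrow> 0 < h k"
    "\<And>k. k \<in> {1..<N} \<Longrightarrow> qp k * h (k - 1) + qm (Suc k) * h (Suc k) \<le> \<theta> * h k"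
proof -
  define p where "p k = (\<Prod>j\<in>{1..<k}. qp (Suc j) / qm (Suc j))" for k
  \<comment> \<open>Without the factor 2 the partial sums \<open>c\<close> would be harmonic;
    halving each successive ratio leaves the strict deficit \<open>qm k * d k / 2\<close>.\<close>
  define d where "d k = (\<Prod>j\<in>{1..<k}. qm j / (2 * qp (Suc j)))" for k
  define c where "c k = (\<Sum>j\<in>{1..k}. d j)" for k
  define h where "h k = p k * c k" for k
  have pos: "0 < qp k" "0 < qm k" if "k \<in> {1..N}" for k
    using assms that by (auto simp: collision_parameters_def)
  have p_pos: "0 < p k" and d_pos: "0 < d k" if "k \<in> {1..N}" for k
    unfolding p_def d_def using that pos by (auto intro!: prod_pos mult_pos_pos divide_pos_pos)
  have p_Suc: "p (Suc k) * qm (Suc k) = p k * qp (Suc k)"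
    and d_Suc: "2 * qp (Suc k) * d (Suc k) = qm k * d k" if "k \<in> {1..<N}" for k
    using that pos[of "Suc k"] by (simp_all add: p_def d_def)
  have c_Suc: "c (Suc k) = c k + d (Suc k)" for k
    by (simp add: c_def)
  have h_0: "h 0 = 0" by (simp add: h_def c_def)
  have h_pos: "0 < h k" if "k \<in> {1..N}" for k
    unfolding h_def c_def using that d_pos p_pos by (intro mult_pos_pos sum_pos) auto
  have strict: "qp k * h (k - 1) + qm (Suc k) * h (Suc k) < h k" if k: "k \<in> {1..<N}" for k
  proof -
    obtain i where i: "k = Suc i" using k by (cases k) auto
    \<comment> \<open>The relation for \<open>p\<close> starts at index 1; at the left end both
      sides vanish because \<open>c 0 = 0\<close>.\<close>
    have "qp k * h i = p k * (qm k * c i)"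
    proof (cases "i = 0")
      case False
      then have "p k * qm k = p i * qp k" using p_Suc[of i] k i by simp
      then show ?thesis by (simp add: h_def algebra_simps)
    qed (simp add: h_def c_def)
    moreover have "qm (Suc k) * h (Suc k) = p k * (qp (Suc k) * c (Suc k))"
      using p_Suc[OF k] by (simp add: h_def algebra_simps)
    moreover have "qm k * c i + qp (Suc k) * c (Suc k) = c k - qm k * d k / 2"
    proof -
      have "qp (Suc k) = 1 - qm k"
        using assms k by (simp add: collision_parameters_def eq_diff_eq)
      then have "qp (Suc k) * c k = c k - qm k * c k"
        by (simp only: left_diff_distrib mult_1)
      moreover have "qm k * c i = qm k * c k - qm k * d k"
        using c_Suc[of i] i by (simp add: algebra_simps)
      moreover have "qp (Suc k) * c (Suc k) = qp (Suc k) * c k + qm k * d k / 2"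
        using d_Suc[OF k] by (simp add: c_Suc algebra_simps)
      ultimately show ?thesis by simp
    qed
    ultimately have "qp k * h i + qm (Suc k) * h (Suc k) = p k * (c k - qm k * d k / 2)"
      by (simp add: distrib_left[symmetric])
    moreover have "p k * (c k - qm k * d k / 2) < p k * c k"
      using p_pos[of k] pos[of k] d_pos[of k] k by simp
    ultimately show ?thesis by (simp add: h_def i)
  qed
  \<comment> \<open>Finitely many strict inequalities give a uniform factor. The inserted 0 makes
    \<theta> nonnegative and the maximum meaningful when there are no gaps.\<close>
  define \<theta> where
    "\<theta> = Max (insert 0 ((\<lambda>k. (qp k * h (k - 1) + qm (Suc k) * h (Suc k)) / h k) ` {1..<N}))"
  show thesis
  proof (rule that[of \<theta> h, OF _ _ h_0 h_pos])
    show "0 \<le> \<theta>" unfolding \<theta>_def by (intro Max_ge) auto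
    show "\<theta> < 1" unfolding \<theta>_def using strict h_pos by (subst Max_less_iff) auto
    show "qp k * h (k - 1) + qm (Suc k) * h (Suc k) \<le> \<theta> * h k" if k: "k \<in> {1..<N}" for k
    proof -
      have "(qp k * h (k - 1) + qm (Suc k) * h (Suc k)) / h k \<le> \<theta>"
        unfolding \<theta>_def using k by (intro Max_ge) auto
      then show ?thesis using h_pos[of k] k by (simp add: pos_divide_le_eq)
    qed
  qed auto
qed

section \<open>Comparison of two paths\<close>

text \<open>A single outcome, stripped of probability. The input \<open>x\<close> collects drift and
  noise; it is shared by the two paths compared below and cancels in their difference.\<close>

locale particle_path =
  fixes N :: nat and qp qm :: "nat \<Rightarrow> real" and x y l :: "nat \<Rightarrow> real \<Rightarrow> real"
  assumes params: "collision_parameters N qp qm"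
    and continuous_y: "k \<in> {1..N} \<Longrightarrow> continuous_on {0..} (y k)"
    and continuous_l: "k \<in> {1..<N} \<Longrightarrow> continuous_on {0..} (l k)"
    and ordered: "0 \<le> t \<Longrightarrow> k \<in> {1..<N} \<Longrightarrow> y k t \<le> y (Suc k) t"
    and l_boundary: "0 \<le> t \<Longrightarrow> l 0 t = 0" "0 \<le> t \<Longrightarrow> l N t = 0"
    and dynamics: "0 \<le> t \<Longrightarrow> k \<in> {1..N} \<Longrightarrow>
      y k t = y k 0 + x k t + qp k * l (k - 1) t - qm k * l k t"
    and l_start: "k \<in> {1..<N} \<Longrightarrow> l k 0 = 0"
    and mono_l: "k \<in> {1..<N} \<Longrightarrow> mono_on {0..} (l k)"
    and growth: "k \<in> {1..<N} \<Longrightarrow> 0 \<le> s \<Longrightarrow> s < t \<Longrightarrow> l k s < l k t \<Longrightarrow>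
      \<exists>u\<in>{s..t}. y k u = y (Suc k) u"
begin

lemma l_le: "k \<in> {1..<N} \<Longrightarrow> 0 \<le> s \<Longrightarrow> s \<le> t \<Longrightarrow> l k s \<le> l k t"
  using mono_onD[OF mono_l, of k s t] by simp

lemma collision_term_reflector:
  assumes "k \<in> {1..<N}" "0 \<le> t"
  shows "l k t = reflector (\<lambda>s. y (Suc k) s - y k s - l k s) t"
proof (rule skorokhod_solution_eq_reflector)
  show "continuous_on {0..} (\<lambda>s. y (Suc k) s - y k s)"
    using assms by (intro continuous_on_diff continuous_y) auto
  show "0 \<le> y (Suc k) s - y k s" if "0 \<le> s" for s
    using ordered[OF that] assms by simp
  show "\<exists>u\<in>{r..s}. y (Suc k) u - y k u = 0" if "0 \<le> r" "r < s" "l k r < l k s" for r s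
    using growth[OF assms(1) that] by force
qed (rule continuous_l l_start mono_l assms)+

lemma l_nonneg: "k \<in> {1..<N} \<Longrightarrow> 0 \<le> t \<Longrightarrow> 0 \<le> l k t"
  using l_le[of k 0 t] l_start[of k] by simp

end

section \<open>Comparison of positions by a weighted quadratic functional\<close>

text \<open>Chaining over an equidistant grid of mesh below \<delta> turns a local estimate, such as
  one from uniform continuity, into a global one.\<close>

lemma antitone_of_small_increments:
  fixes G :: "real \<Rightarrow> real"
  assumes "0 < \<delta>" "0 \<le> T"
    and "\<And>s t. 0 \<le> s \<Longrightarrow> s \<le> t \<Longrightarrow> t \<le> T \<Longrightarrow> t - s < \<delta> \<Longrightarrow> G t \<le> G s"
  shows "G T \<le> G 0"
proof -
  obtain n :: nat where n: "T / \<delta> < real n" using reals_Archimedean2 by blast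
  moreover have "0 \<le> T / \<delta>" using assms by simp
  ultimately have "0 < n" by (cases n) auto
  have step: "T / n < \<delta>" using n \<open>0 < n\<close> assms(1) by (simp add: field_simps)
  have "G (i * T / n) \<le> G 0" if "i \<le> n" for i
    using that
  proof (induction i)
    case (Suc i)
    have "real (Suc i) * T \<le> n * T"
      using Suc.prems \<open>0 \<le> T\<close> by (intro mult_right_mono) auto
    then have "Suc i * T / n \<le> T"
      using \<open>0 < n\<close> by (simp add: field_simps)
    moreover have "Suc i * T / n - i * T / n = T / n"
      by (simp add: distrib_right add_divide_distrib)
    moreover have "0 \<le> i * T / n" "0 \<le> T / n"
      using \<open>0 \<le> T\<close> by auto
    ultimately have "G (Suc i * T / n) \<le> G (i * T / n)"
      using step by (intro assms(3)) linarith+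
    then show ?case using Suc by simp
  qed simp
  from this[of n] show ?thesis using \<open>0 < n\<close> by simp
qed

text \<open>The tangent inequality at \<open>b\<close> for the convex function
  \<open>(min a 0)\<^sup>2\<close>, whose derivative is \<open>2 * min a 0\<close>. It replaces the
  chain rule by an estimate on increments.\<close>

lemma min_0_square_convex:
  fixes a b :: real
  shows "(min b 0)\<^sup>2 - (min a 0)\<^sup>2 \<le> 2 * min b 0 * (b - a)"
proof -
  have "2 * n * (b - a) - (n\<^sup>2 - m\<^sup>2) = (n - m)\<^sup>2 + 2 * (n * b - n * n) + 2 * (n * (m - a))"
    for m n :: real
    by (simp add: power2_eq_square algebra_simps)
  note eq = this[of "min b 0" "min a 0"]
  have "min b 0 * b - min b 0 * min b 0 = 0" by (simp add: min_def)
  moreover have "0 \<le> min b 0 * (min a 0 - a)" by (intro mult_nonpos_nonpos) auto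
  ultimately have "0 \<le> 2 * min b 0 * (b - a) - ((min b 0)\<^sup>2 - (min a 0)\<^sup>2)"
    unfolding eq by simp
  then show ?thesis by (simp only: diff_ge_0_iff_ge)
qed

locale particle_path_pair =
  P: particle_path N qp qm x y l + P': particle_path N qp qm x y' l'
  for N qp qm x y l y' l'
begin

text \<open>Abel summation: shifting the first sum gathers both occurrences of \<open>E k\<close>,
  the balance relation equates their coefficients, and the vanishing end terms leave no boundary
  contribution.\<close>

lemma summation_by_parts:
  fixes a :: "nat \<Rightarrow> real"
  assumes "E 0 = 0" "E N = 0"
    and w: "\<And>k. k \<in> {1..<N} \<Longrightarrow> w k * qm k = w (Suc k) * qp (Suc k)"
  shows "(\<Sum>k\<in>{1..N}. w k * a k * (qp k * E (k - 1) - qm k * E k))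
    = (\<Sum>k\<in>{1..<N}. w k * qm k * (E k * (a (Suc k) - a k)))"
proof (cases N)
  case (Suc n)
  have "(\<Sum>k\<in>{1..N}. w k * a k * (qp k * E (k - 1) - qm k * E k))
      = (\<Sum>k\<in>{1..N}. w k * a k * qp k * E (k - 1)) - (\<Sum>k\<in>{1..N}. w k * a k * qm k * E k)"
    by (simp add: sum_subtractf[symmetric] algebra_simps)
  also have "(\<Sum>k\<in>{1..N}. w k * a k * qp k * E (k - 1))
      = (\<Sum>k\<in>{0..n}. w (Suc k) * a (Suc k) * qp (Suc k) * E k)"
    using sum.shift_bounds_cl_Suc_ivl[of "\<lambda>k. w k * a k * qp k * E (k - 1)" 0 n] Suc by simp
  also have "\<dots> = (\<Sum>k\<in>{1..<N}. w (Suc k) * a (Suc k) * qp (Suc k) * E k)"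
    using assms(1) Suc by (simp add: sum.atLeast_Suc_atMost atLeastLessThanSuc_atLeastAtMost)
  also have "(\<Sum>k\<in>{1..N}. w k * a k * qm k * E k) = (\<Sum>k\<in>{1..<N}. w k * a k * qm k * E k)"
    using assms(2) Suc by (simp add: atLeastLessThanSuc_atLeastAtMost)
  also have "(\<Sum>k\<in>{1..<N}. w (Suc k) * a (Suc k) * qp (Suc k) * E k)
        - (\<Sum>k\<in>{1..<N}. w k * a k * qm k * E k)
      = (\<Sum>k\<in>{1..<N}. w k * qm k * (E k * (a (Suc k) - a k)))"
  proof (subst sum_subtractf[symmetric], rule sum.cong[OF refl])
    fix k assume k: "k \<in> {1..<N}"
    have "w (Suc k) * a (Suc k) * qp (Suc k) * E k = w k * qm k * (a (Suc k) * E k)"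
      unfolding w[OF k] by simp
    then show "w (Suc k) * a (Suc k) * qp (Suc k) * E k - w k * a k * qm k * E k
        = w k * qm k * (E k * (a (Suc k) - a k))"
      by (simp only: algebra_simps)
  qed
  finally show ?thesis .
qed simp

text \<open>Over short intervals \<open>G\<close> increases by at most \<open>e\<close> times the
  increase of the total collision term \<open>V\<close>. So \<open>G - e * V\<close> is
  nonincreasing for every positive \<open>e\<close>, and letting \<open>e\<close> tend to 0 gives
  \<open>G T \<le> 0\<close>.\<close>

lemma positions_comparison:
  assumes start: "\<And>k. k \<in> {1..N} \<Longrightarrow> y k 0 \<le> y' k 0"
    and "0 \<le> T" "i \<in> {1..N}"
  shows "y i T \<le> y' i T"
proof -
  obtain w where w_pos: "\<And>k. k \<in> {1..N} \<Longrightarrow> 0 < w k"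
    and w: "\<And>k. k \<in> {1..<N} \<Longrightarrow> w k * qm k = w (Suc k) * qp (Suc k)"
    using exists_balancing_weights[OF P.params] by blast
  define f where "f k t = y' k t - y k t" for k t
  define a where "a k t = min (f k t) 0" for k t
  define G where "G t = (\<Sum>k\<in>{1..N}. w k * (a k t)\<^sup>2)" for t
  define V where "V t = (\<Sum>k\<in>{1..<N}. w k * qm k * (l k t + l' k t))" for t
  have wq: "0 \<le> w k * qm k" if "k \<in> {1..<N}" for k
    using w_pos[of k] P.params that
    by (auto simp: collision_parameters_def intro!: mult_nonneg_nonneg less_imp_le)
  have small: "G T \<le> e * V T" if "0 < e" for e
  proof -
    \<comment> \<open>The bound \<open>e / 4\<close> is chosen because two components move, each
      with factor 2, for a total error of at most \<open>e\<close>.\<close>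
    have "\<exists>\<delta>>0. \<forall>s\<in>{0..T}. \<forall>t\<in>{0..T}. \<bar>t - s\<bar> < \<delta> \<longrightarrow> \<bar>a k t - a k s\<bar> < e / 4"
      if k: "k \<in> {1..N}" for k
    proof -
      have "continuous_on {0..T} (a k)"
        unfolding a_def f_def
        by (intro continuous_intros; rule continuous_on_subset[of "{0..}"])
          (use k P.continuous_y P'.continuous_y in auto)
      then have "uniformly_continuous_on {0..T} (a k)"
        by (intro compact_uniformly_continuous) auto
      then show ?thesis
        using \<open>0 < e\<close> unfolding uniformly_continuous_on_def dist_real_def
        by (auto elim!: allE[of _ "e / 4"])
    qed
    then obtain \<delta> where \<delta>: "\<And>k. k \<in> {1..N} \<Longrightarrow> 0 < \<delta> k"
      "\<And>k s t. k \<in> {1..N} \<Longrightarrow> s \<in> {0..T} \<Longrightarrow> t \<in> {0..T} \<Longrightarrow> \<bar>t - s\<bar> < \<delta> k \<Longrightarrow>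
        \<bar>a k t - a k s\<bar> < e / 4"
      by metis
    define \<delta>0 where "\<delta>0 = Min (insert 1 (\<delta> ` {1..N}))"
    have \<delta>0: "0 < \<delta>0" "\<And>k. k \<in> {1..N} \<Longrightarrow> \<delta>0 \<le> \<delta> k"
      unfolding \<delta>0_def using \<delta>(1) by (simp, intro Min_le) auto
    have "G T - e * V T \<le> G 0 - e * V 0"
    proof (rule antitone_of_small_increments[OF \<delta>0(1) \<open>0 \<le> T\<close>])
      fix s t assume st: "0 \<le> s" "s \<le> t" "t \<le> T" "t - s < \<delta>0"
      define E where "E k = (l' k t - l' k s) - (l k t - l k s)" for k
      have E_bd: "E 0 = 0" "E N = 0"
        using st by (simp_all add: E_def P.l_boundary P'.l_boundary)
      have f_inc: "f k t - f k s = qp k * E (k - 1) - qm k * E k" if "k \<in> {1..N}" for k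
        using P.dynamics[of t k] P.dynamics[of s k] P'.dynamics[of t k] P'.dynamics[of s k]
          that st by (simp add: f_def E_def algebra_simps)
      have "G t - G s = (\<Sum>k\<in>{1..N}. w k * ((a k t)\<^sup>2 - (a k s)\<^sup>2))"
        by (simp add: G_def sum_subtractf[symmetric] algebra_simps)
      also have "\<dots> \<le> (\<Sum>k\<in>{1..N}. w k * (2 * a k t * (f k t - f k s)))"
        unfolding a_def using w_pos
        by (intro sum_mono mult_left_mono min_0_square_convex) (auto intro: less_imp_le)
      also have "\<dots> = (\<Sum>k\<in>{1..N}. w k * (2 * a k t) * (qp k * E (k - 1) - qm k * E k))"
        by (intro sum.cong) (simp_all add: f_inc)
      also have "\<dots> = (\<Sum>k\<in>{1..<N}. w k * qm k * (E k * (2 * a (Suc k) t - 2 * a k t)))"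
        by (rule summation_by_parts[OF E_bd w])
      also have "\<dots> \<le> (\<Sum>k\<in>{1..<N}. w k * qm k *
          (e * ((l k t + l' k t) - (l k s + l' k s))))"
      proof (intro sum_mono mult_left_mono wq)
        fix k assume k: "k \<in> {1..<N}"
        have near: "\<bar>a j t - a j u\<bar> < e / 4" if "j \<in> {k, Suc k}" "u \<in> {s..t}" for j u
          using that st k \<delta>0(2)[of j] by (intro \<delta>(2)) auto
        \<comment> \<open>The order of \<open>a k\<close> and \<open>a (Suc k)\<close> is known only
          at some collision time \<open>u\<close> in the interval; the modulus of continuity carries
          it to \<open>t\<close> with error \<open>e\<close>.\<close>
        have "(l' k t - l' k s) * (2 * a (Suc k) t - 2 * a k t) \<le> (l' k t - l' k s) * e"
        proof (cases "l' k s < l' k t")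
          case True
          then have "s < t" using st by (cases "s = t") auto
          then obtain u where u: "u \<in> {s..t}" "y' k u = y' (Suc k) u"
            using P'.growth[OF k st(1)] True by blast
          then have "a (Suc k) u \<le> a k u"
            using P.ordered[of u k] k st by (simp add: a_def f_def min_def)
          moreover have "\<bar>a k t - a k u\<bar> < e / 4" "\<bar>a (Suc k) t - a (Suc k) u\<bar> < e / 4"
            using near u(1) by blast+
          ultimately have "2 * a (Suc k) t - 2 * a k t \<le> e"
            by linarith
          then show ?thesis
            using True by (intro mult_left_mono) auto
        next
          case False
          then show ?thesis using P'.l_le[OF k st(1,2)] by simp
        qed
        moreover have "(l k t - l k s) * (2 * a k t - 2 * a (Suc k) t) \<le> (l k t - l k s) * e"
        proof (cases "l k s < l k t")
          case True
          then have "s < t" using st by (cases "s = t") auto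
          then obtain u where u: "u \<in> {s..t}" "y k u = y (Suc k) u"
            using P.growth[OF k st(1)] True by blast
          then have "a k u \<le> a (Suc k) u"
            using P'.ordered[of u k] k st by (simp add: a_def f_def min_def)
          moreover have "\<bar>a k t - a k u\<bar> < e / 4" "\<bar>a (Suc k) t - a (Suc k) u\<bar> < e / 4"
            using near u(1) by blast+
          ultimately have "2 * a k t - 2 * a (Suc k) t \<le> e"
            by linarith
          then show ?thesis
            using True by (intro mult_left_mono) auto
        next
          case False
          then show ?thesis using P.l_le[OF k st(1,2)] by simp
        qed
        ultimately show "E k * (2 * a (Suc k) t - 2 * a k t)
            \<le> e * ((l k t + l' k t) - (l k s + l' k s))"
          by (simp add: E_def algebra_simps)
      qed
      also have "\<dots> = e * (V t - V s)"
        by (simp add: V_def sum_subtractf[symmetric] sum_distrib_left algebra_simps)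
      finally show "G t - e * V t \<le> G s - e * V s" by (simp add: algebra_simps)
    qed
    moreover have "G 0 = 0"
      using start by (simp add: G_def a_def f_def)
    moreover have "V 0 = 0"
      by (simp add: V_def P.l_start P'.l_start)
    ultimately show ?thesis by simp
  qed
  have V: "0 \<le> V T"
    unfolding V_def using \<open>0 \<le> T\<close>
    by (intro sum_nonneg mult_nonneg_nonneg[OF wq] add_nonneg_nonneg P.l_nonneg P'.l_nonneg)
  have "G T \<le> 0"
  proof (rule field_le_epsilon)
    fix e :: real assume "0 < e"
    \<comment> \<open>Adding 1 keeps the denominator positive when \<open>V T = 0\<close>.\<close>
    have "G T \<le> e / (V T + 1) * V T"
      using small[of "e / (V T + 1)"] \<open>0 < e\<close> V by simp
    also have "\<dots> \<le> e"
      using \<open>0 < e\<close> V by (simp add: field_simps)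
    finally show "G T \<le> 0 + e" by simp
  qed
  moreover have "w i * (a i T)\<^sup>2 \<le> G T"
    unfolding G_def using \<open>i \<in> {1..N}\<close> w_pos
    by (intro member_le_sum) (auto simp: less_imp_le)
  ultimately have "w i * (a i T)\<^sup>2 \<le> 0" by simp
  then have "a i T = 0"
    using w_pos[OF \<open>i \<in> {1..N}\<close>] by (simp add: mult_le_0_iff)
  then show ?thesis by (simp add: a_def f_def min_def split: if_splits)
qed

section \<open>Comparison of gaps and collision terms by Picard iteration\<close>

text \<open>The amount by which collisions at the two neighbouring gaps narrow gap
  \<open>k\<close>.\<close>

definition feedback :: "(nat \<Rightarrow> real \<Rightarrow> real) \<Rightarrow> nat \<Rightarrow> real \<Rightarrow> real" where
  "feedback m k t = qp k * m (k - 1) t + qm (Suc k) * m (Suc k) t"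

text \<open>By the dynamics this is the initial gap plus the difference of driving terms. Writing it
  through \<open>y\<close> and \<open>l\<close> makes its boundedness and the fixed-point property
  of \<open>l\<close> immediate.\<close>

definition free_gap :: "nat \<Rightarrow> real \<Rightarrow> real" where
  "free_gap k t = y (Suc k) t - y k t - l k t + feedback l k t"

text \<open>Each gap is reflected separately, with its neighbours' collision terms frozen at
  \<open>m\<close>. The value 0 at other indices respects the boundary convention for collision
  terms.\<close>

definition picard :: "(nat \<Rightarrow> real \<Rightarrow> real) \<Rightarrow> nat \<Rightarrow> real \<Rightarrow> real" where
  "picard m k = (if k \<in> {1..<N} then reflector (\<lambda>t. free_gap k t - feedback m k t) else (\<lambda>_. 0))"

abbreviation iter :: "nat \<Rightarrow> nat \<Rightarrow> real \<Rightarrow> real" where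
  "iter n \<equiv> (picard ^^ n) l'"

lemma parameter_nonneg: "k \<in> {1..<N} \<Longrightarrow> 0 \<le> qp k \<and> 0 \<le> qm (Suc k)"
  using P.params by (simp add: collision_parameters_def less_imp_le)

text \<open>Since \<open>qp (Suc k) + qm k = 1\<close>, a gap's own collision term enters with
  coefficient 1, so subtracting it leaves only the neighbours' feedback. The common driving terms
  make \<open>free_gap\<close> usable for both paths, up to the initial gaps.\<close>

lemma free_gap_shift:
  assumes "0 \<le> t" "k \<in> {1..<N}"
  shows "y' (Suc k) t - y' k t - l' k t
    = free_gap k t - feedback l' k t + ((y' (Suc k) 0 - y' k 0) - (y (Suc k) 0 - y k 0))"
proof -
  have "qp (Suc k) = 1 - qm k"
    using P.params assms by (simp add: collision_parameters_def eq_diff_eq)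
  then have "qp (Suc k) * l k t = l k t - qm k * l k t" "qp (Suc k) * l' k t = l' k t - qm k * l' k t"
    by (simp_all only: left_diff_distrib mult_1)
  then show ?thesis
    using P.dynamics[of t k] P.dynamics[of t "Suc k"] P'.dynamics[of t k] P'.dynamics[of t "Suc k"]
      assms by (simp add: free_gap_def feedback_def)
qed

lemma bounded_feedback:
  assumes "k \<in> {1..<N}" "\<And>j. j \<le> N \<Longrightarrow> bounded (m j ` {0..t})"
  shows "bounded (feedback m k ` {0..t})"
proof -
  have *: "bounded ((\<lambda>s. c * m j s) ` {0..t})" if "j \<le> N" for c j
    using bounded_scaling[OF assms(2)[OF that], of c] by (simp add: image_image)
  have "k - 1 \<le> N" "Suc k \<le> N" using assms(1) by auto
  then show ?thesis
    unfolding feedback_def[abs_def] by (rule bounded_plus_comp[OF * *])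
qed

lemma bounded_null_image: "(\<And>s. 0 \<le> s \<Longrightarrow> f s = 0) \<Longrightarrow> bounded (f ` {0..t::real})"
  for f :: "real \<Rightarrow> real"
  by (rule bounded_subset[of "{0}"]) auto

lemma bounded_collision_terms:
  assumes "j \<le> N"
  shows "bounded (l j ` {0..t})" "bounded (l' j ` {0..t})"
proof -
  consider "j \<in> {1..<N}" | "j = 0" | "j = N" using assms by fastforce
  then have "bounded (l j ` {0..t}) \<and> bounded (l' j ` {0..t})"
    by cases (simp_all add: mono_bounded_image P.mono_l P'.mono_l bounded_null_image
        P.l_boundary P'.l_boundary)
  then show "bounded (l j ` {0..t})" "bounded (l' j ` {0..t})" by auto
qed

lemma bounded_picard_input:
  assumes k: "k \<in> {1..<N}" and "\<And>j. j \<le> N \<Longrightarrow> bounded (m j ` {0..t})"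
  shows "bounded ((\<lambda>s. free_gap k s - feedback m k s) ` {0..t})"
proof -
  have y: "bounded (y (Suc k) ` {0..t})" "bounded (y k ` {0..t})"
    using k by (auto intro!: continuous_bounded_image P.continuous_y)
  have l: "bounded (l k ` {0..t})"
    using k by (intro bounded_collision_terms) auto
  have fb: "bounded (feedback l k ` {0..t})" "bounded (feedback m k ` {0..t})"
    by (intro bounded_feedback[OF k] bounded_collision_terms(1) assms(2); assumption)+
  show ?thesis
    unfolding free_gap_def
    by (rule bounded_minus_comp[OF bounded_plus_comp[OF bounded_minus_comp[OF
            bounded_minus_comp[OF y] l] fb(1)] fb(2)])
qed

lemma collision_term_fixpoint:
  assumes "k \<in> {1..<N}" "0 \<le> t"
  shows "l k t = picard l k t"
  using P.collision_term_reflector[OF assms] assms by (simp add: picard_def free_gap_def)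

lemma iter_boundary: "0 \<le> t \<Longrightarrow> iter n 0 t = 0 \<and> iter n N t = 0"
  by (cases n) (auto simp: picard_def P'.l_boundary)

lemma bounded_iter:
  assumes "\<And>k. k \<in> {1..<N} \<Longrightarrow> mono_on {0..} (\<lambda>t. iter n k t - l' k t)" "j \<le> N"
  shows "bounded (iter n j ` {0..t})"
proof (cases "j \<in> {1..<N}")
  case True
  have "bounded ((\<lambda>s. (iter n j s - l' j s) + l' j s) ` {0..t})"
    by (intro bounded_plus_comp mono_bounded_image assms(1) True bounded_collision_terms(2) assms(2))
  then show ?thesis by simp
next
  case False
  then have "j = 0 \<or> j = N" using assms(2) by auto
  then show ?thesis
    using iter_boundary by (auto intro: bounded_null_image)
qed

text \<open>Let \<open>u\<close> be the input of the iterate and \<open>u'\<close> that of the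
  primed gap. Then \<open>u' - u\<close> is a nonnegative combination of \<open>iter n - l'\<close>
  at the neighbours plus the initial gap difference, hence nondecreasing and nonnegative at 0. The
  two one-dimensional comparisons give the claims.\<close>

lemma picard_step:
  assumes gaps: "\<And>k. k \<in> {1..<N} \<Longrightarrow> y (Suc k) 0 - y k 0 \<le> y' (Suc k) 0 - y' k 0"
    and mono: "\<And>k. k \<in> {1..<N} \<Longrightarrow> mono_on {0..} (\<lambda>t. iter n k t - l' k t)"
    and k: "k \<in> {1..<N}"
  shows "mono_on {0..} (\<lambda>t. iter (Suc n) k t - l' k t)"
    and "0 \<le> t \<Longrightarrow> free_gap k t - feedback (iter n) k t + iter (Suc n) k t \<le> y' (Suc k) t - y' k t"
proof -
  define u where "u t = free_gap k t - feedback (iter n) k t" for t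
  define u' where "u' t = (y' (Suc k) t - y' k t) - l' k t" for t
  have bd: "bounded (u ` {0..t})" for t
    unfolding u_def using k bounded_iter[OF mono] by (intro bounded_picard_input) auto
  have bd': "bounded (u' ` {0..t})" for t
    unfolding u'_def using k
    by (intro continuous_bounded_image continuous_on_diff P'.continuous_y P'.continuous_l) auto
  have inc: "iter n j s - l' j s \<le> iter n j t - l' j t" if "0 \<le> s" "s \<le> t" "j \<le> N" for j s t
  proof (cases "j \<in> {1..<N}")
    case True
    then show ?thesis using mono_onD[OF mono, of j s t] that by simp
  next
    case False
    then have "j = 0 \<or> j = N" using that by auto
    then show ?thesis using that iter_boundary P'.l_boundary by auto
  qed
  have diff: "u' t - u t = (qp k * (iter n (k - 1) t - l' (k - 1) t)
      + qm (Suc k) * (iter n (Suc k) t - l' (Suc k) t))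
      + ((y' (Suc k) 0 - y' k 0) - (y (Suc k) 0 - y k 0))" if "0 \<le> t" for t
    using free_gap_shift[OF that k] by (simp add: u_def u'_def feedback_def algebra_simps)
  have mono_diff: "mono_on {0..} (\<lambda>t. u' t - u t)"
  proof (rule mono_onI)
    fix s t :: real assume st: "s \<in> {0..}" "t \<in> {0..}" "s \<le> t"
    have "qp k * (iter n (k - 1) s - l' (k - 1) s) \<le> qp k * (iter n (k - 1) t - l' (k - 1) t)"
      "qm (Suc k) * (iter n (Suc k) s - l' (Suc k) s) \<le> qm (Suc k) * (iter n (Suc k) t - l' (Suc k) t)"
      using st k parameter_nonneg[OF k] by (auto intro!: mult_left_mono inc)
    then show "u' s - u s \<le> u' t - u t" using diff[of s] diff[of t] st by simp
  qed
  \<comment> \<open>The iteration starts at \<open>l'\<close> itself; every later iterate is a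
    regulator, hence nonnegative at time 0, where \<open>l'\<close> vanishes.\<close>
  have iter_0: "iter n j 0 - l' j 0 \<ge> 0" if "j \<le> N" for j
  proof (cases n)
    case (Suc m)
    show ?thesis
    proof (cases "j \<in> {1..<N}")
      case True
      have "0 \<le> iter n j 0"
        unfolding Suc using True by (simp add: picard_def reflector_def)
      then show ?thesis using P'.l_start[OF True] by simp
    next
      case False
      then have "j = 0 \<or> j = N" using that by auto
      then show ?thesis using iter_boundary P'.l_boundary by auto
    qed
  qed simp
  have start: "u 0 \<le> u' 0"
  proof -
    have "0 \<le> qp k * (iter n (k - 1) 0 - l' (k - 1) 0)"
      "0 \<le> qm (Suc k) * (iter n (Suc k) 0 - l' (Suc k) 0)"
      using k parameter_nonneg[OF k] by (auto intro!: mult_nonneg_nonneg iter_0)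
    then show ?thesis using diff[of 0] gaps[OF k] by simp
  qed
  have iter_Suc: "iter (Suc n) k t = reflector u t" for t
    using k by (simp add: picard_def u_def[abs_def])
  have l': "l' k t = reflector u' t" if "0 \<le> t" for t
    using P'.collision_term_reflector[OF k that] by (simp add: u'_def[abs_def])
  show "mono_on {0..} (\<lambda>t. iter (Suc n) k t - l' k t)"
  proof (rule mono_onI)
    fix s t :: real assume st: "s \<in> {0..}" "t \<in> {0..}" "s \<le> t"
    then show "iter (Suc n) k s - l' k s \<le> iter (Suc n) k t - l' k t"
      using reflector_increment_antimono[OF bd bd' start mono_diff, of s t]
      unfolding iter_Suc by (simp add: l')
  qed
  show "free_gap k t - feedback (iter n) k t + iter (Suc n) k t \<le> y' (Suc k) t - y' k t"
    if "0 \<le> t"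
    using reflected_path_mono[where u = u and u' = u', OF that bd' start mono_diff] l'[OF that]
    unfolding iter_Suc by (simp add: u_def u'_def)
qed

lemma iter_mono:
  assumes "\<And>k. k \<in> {1..<N} \<Longrightarrow> y (Suc k) 0 - y k 0 \<le> y' (Suc k) 0 - y' k 0" "k \<in> {1..<N}"
  shows "mono_on {0..} (\<lambda>t. iter n k t - l' k t)"
  using assms(2)
proof (induction n arbitrary: k)
  case 0
  then show ?case by (simp add: mono_on_def)
next
  case (Suc n)
  then show ?case using picard_step(1)[OF assms(1)] by blast
qed

text \<open>The collision terms \<open>l\<close> are a fixed point of \<open>picard\<close>.
  Reflection is 1-Lipschitz in the supremum norm and the feedback contracts by \<theta> in the norm
  weighted by \<open>h\<close>, so the error decays geometrically.\<close>

lemma iter_tendsto: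
  assumes gaps: "\<And>k. k \<in> {1..<N} \<Longrightarrow> y (Suc k) 0 - y k 0 \<le> y' (Suc k) 0 - y' k 0"
    and "0 \<le> T" "i \<le> N"
  shows "(\<lambda>n. iter n i T) \<longlonglongrightarrow> l i T"
proof -
  obtain h \<theta> where \<theta>: "0 \<le> \<theta>" "\<theta> < 1" and h_0: "h 0 = 0"
    and h_pos: "\<And>k. k \<in> {1..N} \<Longrightarrow> 0 < h k"
    and h: "\<And>k. k \<in> {1..<N} \<Longrightarrow> qp k * h (k - 1) + qm (Suc k) * h (Suc k) \<le> \<theta> * h k"
    by (rule exists_contraction_weights[OF P.params]) (rule that)
  \<comment> \<open>Chosen so that the initial error of \<open>l'\<close> against \<open>l\<close>
    is at most \<open>C * h k\<close> throughout \<open>{0..T}\<close>; by monotonicity the values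
    at \<open>T\<close> suffice.\<close>
  define C where "C = (\<Sum>j\<in>{1..<N}. (l j T + l' j T) / h j)"
  have terms: "0 \<le> (l j T + l' j T) / h j" if "j \<in> {1..<N}" for j
    using that \<open>0 \<le> T\<close>
    by (intro divide_nonneg_pos add_nonneg_nonneg h_pos P.l_nonneg P'.l_nonneg) auto
  have "0 \<le> C" unfolding C_def using terms by (rule sum_nonneg)
  have h_nonneg: "0 \<le> h k" if "k \<le> N" for k
    using h_0 h_pos[of k] that by (cases "k = 0") auto
  \<comment> \<open>All times up to \<open>T\<close> and all indices are treated together, as
    \<open>reflector\<close> looks at the whole past and \<open>feedback\<close> at both
    neighbours.\<close>
  have bound: "\<bar>iter n k s - l k s\<bar> \<le> C * \<theta> ^ n * h k" if "k \<le> N" "s \<in> {0..T}" for n k s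
    using that
  proof (induction n arbitrary: k s)
    case 0
    show ?case
    proof (cases "k \<in> {1..<N}")
      case True
      have "(l k T + l' k T) / h k \<le> C"
        unfolding C_def using True terms by (intro member_le_sum) auto
      then have "l k T + l' k T \<le> C * h k"
        using h_pos[of k] True by (simp add: pos_divide_le_eq)
      moreover have "0 \<le> l k s" "l k s \<le> l k T" "0 \<le> l' k s" "l' k s \<le> l' k T"
        using 0(2) by (auto intro!: P.l_nonneg[OF True] P'.l_nonneg[OF True] P.l_le[OF True] P'.l_le[OF True])
      ultimately show ?thesis by (simp add: abs_le_iff)
    next
      case False
      then have "k = 0 \<or> k = N" using 0 by auto
      then have "iter 0 k s = 0" "l k s = 0"
        using 0 P.l_boundary P'.l_boundary by auto
      then show ?thesis using \<open>0 \<le> C\<close> h_nonneg 0 by simp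
    qed
  next
    case (Suc n)
    show ?case
    proof (cases "k \<in> {1..<N}")
      case True
      define u where "u r = free_gap k r - feedback (iter n) k r" for r
      define v where "v r = free_gap k r - feedback l k r" for r
      have bd: "bounded (u ` {0..s})" "bounded (v ` {0..s})"
        unfolding u_def v_def
        by (intro bounded_picard_input True bounded_iter iter_mono gaps bounded_collision_terms;
            assumption)+
      have le_N: "k - 1 \<le> N" "Suc k \<le> N" using True by auto
      have close: "\<bar>u r - v r\<bar> \<le> C * \<theta> ^ Suc n * h k" if r: "r \<in> {0..s}" for r
      proof -
        have "\<bar>u r - v r\<bar> = \<bar>qp k * (iter n (k - 1) r - l (k - 1) r)
            + qm (Suc k) * (iter n (Suc k) r - l (Suc k) r)\<bar>"
          by (subst abs_minus_commute) (simp add: u_def v_def feedback_def algebra_simps)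
        also have "\<dots> \<le> qp k * \<bar>iter n (k - 1) r - l (k - 1) r\<bar>
            + qm (Suc k) * \<bar>iter n (Suc k) r - l (Suc k) r\<bar>"
          using parameter_nonneg[OF True]
          by (intro order_trans[OF abs_triangle_ineq]) (simp add: abs_mult)
        also have "\<dots> \<le> qp k * (C * \<theta> ^ n * h (k - 1)) + qm (Suc k) * (C * \<theta> ^ n * h (Suc k))"
          using parameter_nonneg[OF True] le_N r Suc.prems
          by (intro add_mono mult_left_mono Suc.IH) simp_all
        also have "\<dots> = C * \<theta> ^ n * (qp k * h (k - 1) + qm (Suc k) * h (Suc k))"
          by (simp add: algebra_simps)
        also have "\<dots> \<le> C * \<theta> ^ n * (\<theta> * h k)"
          by (intro mult_left_mono h[OF True] mult_nonneg_nonneg zero_le_power \<theta> \<open>0 \<le> C\<close>)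
        finally show ?thesis by (simp add: algebra_simps)
      qed
      have nonneg: "0 \<le> C * \<theta> ^ Suc n * h k"
        using \<open>0 \<le> C\<close> \<theta> h_nonneg[OF Suc.prems(1)] by simp
      have s: "0 \<le> s" using Suc.prems by simp
      have le: "v r \<le> u r + C * \<theta> ^ Suc n * h k" "u r \<le> v r + C * \<theta> ^ Suc n * h k"
        if "r \<in> {0..s}" for r
        using close[OF that] by linarith+
      have "reflector u s \<le> reflector v s + C * \<theta> ^ Suc n * h k"
        by (intro reflector_le_add s bd nonneg le)
      moreover have "reflector v s \<le> reflector u s + C * \<theta> ^ Suc n * h k"
        by (intro reflector_le_add s bd nonneg le)
      moreover have "iter (Suc n) k s = reflector u s" "l k s = reflector v s"
        unfolding u_def v_def using True collision_term_fixpoint[OF True s]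
        by (simp_all add: picard_def)
      ultimately show ?thesis by linarith
    next
      case False
      then have "k = 0 \<or> k = N" using Suc.prems by auto
      then have "iter (Suc n) k s = 0" "l k s = 0"
        using Suc.prems iter_boundary[of s "Suc n"] P.l_boundary by auto
      then show ?thesis using \<open>0 \<le> C\<close> \<theta> h_nonneg Suc.prems by simp
    qed
  qed
  have lim: "(\<lambda>n. C * \<theta> ^ n * h i) \<longlonglongrightarrow> 0"
    by (intro tendsto_mult_left_zero tendsto_mult_right_zero LIMSEQ_realpow_zero \<theta>)
  have "norm (iter n i T - l i T) \<le> C * \<theta> ^ n * h i" for n
    using bound[OF \<open>i \<le> N\<close>, of T n] \<open>0 \<le> T\<close> by simp
  then have "\<forall>\<^sub>F n in sequentially. norm (iter n i T - l i T) \<le> C * \<theta> ^ n * h i"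
    by (intro always_eventually allI)
  from Lim_null_comparison[OF this lim] show ?thesis by (rule LIM_zero_cancel)
qed

text \<open>The bound of \<open>picard_step\<close> passes to the limit, where its left side becomes
  the gap of \<open>y\<close>.\<close>

lemma gaps_comparison:
  assumes gaps: "\<And>k. k \<in> {1..<N} \<Longrightarrow> y (Suc k) 0 - y k 0 \<le> y' (Suc k) 0 - y' k 0"
    and "0 \<le> t" "k \<in> {1..<N}"
  shows "y (Suc k) t - y k t \<le> y' (Suc k) t - y' k t"
proof -
  have "(\<lambda>n. free_gap k t - feedback (iter n) k t + iter (Suc n) k t)
      \<longlonglongrightarrow> free_gap k t - feedback l k t + l k t"
    unfolding feedback_def using assms(2,3)
    by (intro tendsto_add tendsto_diff tendsto_mult tendsto_const LIMSEQ_Suc[OF iter_tendsto]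
        iter_tendsto gaps) auto
  then have "free_gap k t - feedback l k t + l k t \<le> y' (Suc k) t - y' k t"
    by (rule LIMSEQ_le_const2)
      (use picard_step(2)[OF gaps iter_mono[OF gaps] assms(3,2)] in blast)
  then show ?thesis by (simp add: free_gap_def)
qed

lemma collision_terms_comparison:
  assumes gaps: "\<And>k. k \<in> {1..<N} \<Longrightarrow> y (Suc k) 0 - y k 0 \<le> y' (Suc k) 0 - y' k 0"
    and "0 \<le> s" "s \<le> t" "k \<in> {1..<N}"
  shows "l' k t - l' k s \<le> l k t - l k s"
proof -
  have "(\<lambda>n. iter n k t - iter n k s) \<longlonglongrightarrow> l k t - l k s"
    using assms(2-4) by (intro tendsto_diff iter_tendsto gaps) auto
  moreover have "l' k t - l' k s \<le> iter n k t - iter n k s" for n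
    using mono_onD[OF iter_mono[OF gaps, of k n], of s t] assms by simp
  ultimately show ?thesis by (intro LIMSEQ_le_const) auto
qed

end

section \<open>Almost every path\<close>

lemma competing_brownian_particles_AE_path:
  assumes "competing_brownian_particles M F N g \<sigma> qp qm B Y L"
  shows "AE \<omega> in M. particle_path N qp qm (\<lambda>k t. g k * t + \<sigma> k * B k t \<omega>)
    (\<lambda>k t. Y k t \<omega>) (\<lambda>k t. L k t \<omega>)"
proof -
  from assms[unfolded competing_brownian_particles_def]
  have params: "collision_parameters N qp qm"
    and Y: "\<forall>k\<in>{1..N}. continuous_adapted M F (Y k)"
    and chamber: "AE \<omega> in M. \<forall>t\<ge>0. (\<lambda>k. Y k t \<omega>) \<in> weyl_chamber N"
    and L: "\<forall>k\<in>{1..<N}. continuous_adapted M F (L k)"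
    and boundary: "AE \<omega> in M. \<forall>t\<ge>0. L 0 t \<omega> = 0 \<and> L N t \<omega> = 0"
    and dynamics: "AE \<omega> in M. \<forall>t\<ge>0. \<forall>k\<in>{1..N}. Y k t \<omega> = Y k 0 \<omega> + g k * t + \<sigma> k * B k t \<omega>
      + qp k * L (k - 1) t \<omega> - qm k * L k t \<omega>"
    and growth: "AE \<omega> in M. \<forall>k\<in>{1..<N}. L k 0 \<omega> = 0 \<and> mono_on {0..} (\<lambda>t. L k t \<omega>) \<and>
      (\<forall>s t. 0 \<le> s \<and> s < t \<and> L k s \<omega> < L k t \<omega> \<longrightarrow> (\<exists>u\<in>{s..t}. Y k u \<omega> = Y (Suc k) u \<omega>))"
    by - (elim conjE, assumption)+
  \<comment> \<open>Continuity holds almost surely for each index; finitely many indices allow a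
    common null set.\<close>
  have Y': "AE \<omega> in M. \<forall>k\<in>{1..N}. continuous_on {0..} (\<lambda>t. Y k t \<omega>)"
    using Y by (intro AE_finite_allI) (simp_all add: continuous_adapted_def)
  have L': "AE \<omega> in M. \<forall>k\<in>{1..<N}. continuous_on {0..} (\<lambda>t. L k t \<omega>)"
    using L by (intro AE_finite_allI) (simp_all add: continuous_adapted_def)
  from AE_conjI[OF Y' AE_conjI[OF L' AE_conjI[OF chamber AE_conjI[OF boundary
          AE_conjI[OF dynamics growth]]]]]
  show ?thesis
  proof (rule eventually_mono, elim conjE)
    fix \<omega>
    assume Y: "\<forall>k\<in>{1..N}. continuous_on {0..} (\<lambda>t. Y k t \<omega>)"
      and L: "\<forall>k\<in>{1..<N}. continuous_on {0..} (\<lambda>t. L k t \<omega>)"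
      and chamber: "\<forall>t\<ge>0. (\<lambda>k. Y k t \<omega>) \<in> weyl_chamber N"
      and boundary: "\<forall>t\<ge>0. L 0 t \<omega> = 0 \<and> L N t \<omega> = 0"
      and dynamics: "\<forall>t\<ge>0. \<forall>k\<in>{1..N}. Y k t \<omega> = Y k 0 \<omega> + g k * t + \<sigma> k * B k t \<omega>
        + qp k * L (k - 1) t \<omega> - qm k * L k t \<omega>"
      and growth: "\<forall>k\<in>{1..<N}. L k 0 \<omega> = 0 \<and> mono_on {0..} (\<lambda>t. L k t \<omega>) \<and>
        (\<forall>s t. 0 \<le> s \<and> s < t \<and> L k s \<omega> < L k t \<omega> \<longrightarrow> (\<exists>u\<in>{s..t}. Y k u \<omega> = Y (Suc k) u \<omega>))"
    show "particle_path N qp qm (\<lambda>k t. g k * t + \<sigma> k * B k t \<omega>)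
        (\<lambda>k t. Y k t \<omega>) (\<lambda>k t. L k t \<omega>)"
    proof (rule particle_path.intro)
      show "Y k t \<omega> = Y k 0 \<omega> + (g k * t + \<sigma> k * B k t \<omega>)
          + qp k * L (k - 1) t \<omega> - qm k * L k t \<omega>" if "0 \<le> t" "k \<in> {1..N}" for k t
        using dynamics[rule_format, OF that] by linarith
      show "Y k t \<omega> \<le> Y (Suc k) t \<omega>" if "0 \<le> t" "k \<in> {1..<N}" for k t
        using chamber that unfolding weyl_chamber_def by blast
    qed (use params Y L boundary growth in blast)+
  qed
qed

theorem corollary3p11:
  fixes M :: "'a measure" and F :: "real \<Rightarrow> 'a measure" and N :: nat
    and g \<sigma> qp qm :: "nat \<Rightarrow> real"
    and B Y Y' L L' :: "nat \<Rightarrow> real \<Rightarrow> 'a \<Rightarrow> real"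
  assumes "competing_brownian_particles M F N g \<sigma> qp qm B Y L"
    and "competing_brownian_particles M F N g \<sigma> qp qm B Y' L'"
  defines "Z \<equiv> gap_process Y" and "Z' \<equiv> gap_process Y'"
  shows
    "((AE \<omega> in M. vec_le N (\<lambda>k. Y k 0 \<omega>) (\<lambda>k. Y' k 0 \<omega>)) \<longrightarrow>
       (AE \<omega> in M. \<forall>t\<ge>0. vec_le N (\<lambda>k. Y k t \<omega>) (\<lambda>k. Y' k t \<omega>)))
     \<and>
     ((AE \<omega> in M. vec_le (N - 1) (\<lambda>k. Z k 0 \<omega>) (\<lambda>k. Z' k 0 \<omega>)) \<longrightarrow>
       (AE \<omega> in M. \<forall>t\<ge>0. vec_le (N - 1) (\<lambda>k. Z k t \<omega>) (\<lambda>k. Z' k t \<omega>)) \<and>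
       (AE \<omega> in M. \<forall>s t. 0 \<le> s \<and> s \<le> t \<longrightarrow>
          vec_le (N - 1) (\<lambda>k. L' k t \<omega> - L' k s \<omega>) (\<lambda>k. L k t \<omega> - L k s \<omega>)))"
proof -
  have pair: "AE \<omega> in M. particle_path_pair N qp qm (\<lambda>k t. g k * t + \<sigma> k * B k t \<omega>)
      (\<lambda>k t. Y k t \<omega>) (\<lambda>k t. L k t \<omega>) (\<lambda>k t. Y' k t \<omega>) (\<lambda>k t. L' k t \<omega>)"
    using competing_brownian_particles_AE_path[OF assms(1)]
      competing_brownian_particles_AE_path[OF assms(2)]
    by eventually_elim (rule particle_path_pair.intro)
  have index: "{1..N - 1} = {1..<N}" by auto
  have "AE \<omega> in M. \<forall>t\<ge>0. vec_le N (\<lambda>k. Y k t \<omega>) (\<lambda>k. Y' k t \<omega>)"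
    if "AE \<omega> in M. vec_le N (\<lambda>k. Y k 0 \<omega>) (\<lambda>k. Y' k 0 \<omega>)"
    using pair that
  proof eventually_elim
    case (elim \<omega>)
    then show ?case
      unfolding vec_le_def using particle_path_pair.positions_comparison[OF elim(1)] by blast
  qed
  moreover have "(AE \<omega> in M. \<forall>t\<ge>0. vec_le (N - 1) (\<lambda>k. Z k t \<omega>) (\<lambda>k. Z' k t \<omega>)) \<and>
      (AE \<omega> in M. \<forall>s t. 0 \<le> s \<and> s \<le> t \<longrightarrow>
        vec_le (N - 1) (\<lambda>k. L' k t \<omega> - L' k s \<omega>) (\<lambda>k. L k t \<omega> - L k s \<omega>))"
    if start: "AE \<omega> in M. vec_le (N - 1) (\<lambda>k. Z k 0 \<omega>) (\<lambda>k. Z' k 0 \<omega>)"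
  proof
    show "AE \<omega> in M. \<forall>t\<ge>0. vec_le (N - 1) (\<lambda>k. Z k t \<omega>) (\<lambda>k. Z' k t \<omega>)"
      using pair start
    proof eventually_elim
      case (elim \<omega>)
      then show ?case
        unfolding vec_le_def index Z_def Z'_def gap_process_def
        using particle_path_pair.gaps_comparison[OF elim(1)] by blast
    qed
    show "AE \<omega> in M. \<forall>s t. 0 \<le> s \<and> s \<le> t \<longrightarrow>
        vec_le (N - 1) (\<lambda>k. L' k t \<omega> - L' k s \<omega>) (\<lambda>k. L k t \<omega> - L k s \<omega>)"
      using pair start
    proof eventually_elim
      case (elim \<omega>)
      then show ?case
        unfolding vec_le_def index Z_def Z'_def gap_process_def
        using particle_path_pair.collision_terms_comparison[OF elim(1)] by blast
    qed
  qed
  ultimately show ?thesis by blast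
qed

end
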